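(* There exists a $(40,27,18)$-BIBD admitting a $0$-ULSE $10$-colouring.
   Context: For positive integers $v,k,\lambda$ with $2\le k<v$, a $(v,k,\lambda)$-BIBD is a pair $(V,\mathcal{B})$ where $V$ is a set of $v$ points and $\mathcal{B}$ is a collection of $k$-element subsets of $V$ (blocks) such that every pair of distinct points lies in exactly $\lambda$ blocks. An $\ell$-colouring is a surjective map from $V$ onto a set of $\ell$ colours. A $0$-ULSE $\ell$-colouring is an $\ell$-colouring such that $(\ell-1)$ divides $k$ and in every block exactly one colour does not appear, while each of the other $\ell-1$ colours appears exactly $\frac{k}{\ell-1}$ times in that block. (This is the case $q=d=3$ of the parameters $\left(\frac{q^{d+1}-1}{q-1}, q^d, q^{d-1}(q-1)\right)$ with $\ell=\sqrt{q^{d+1}}+1$.) *)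

theory Defs
  imports Main "HOL-Library.Multiset"
begin

(* The blocks form a multiset, as usual in design theory, so repeated blocks are
   allowed and are counted with multiplicity. *)
definition bibd :: "nat \<Rightarrow> nat \<Rightarrow> nat \<Rightarrow> 'a set \<Rightarrow> 'a set multiset \<Rightarrow> bool" where
  "bibd v k lam V \<B> \<longleftrightarrow>
     2 \<le> k \<and> k < v \<and> 0 < lam \<and>
     finite V \<and> card V = v \<and>
     (\<forall>B \<in># \<B>. B \<subseteq> V \<and> card B = k) \<and>
     (\<forall>x \<in> V. \<forall>y \<in> V. x \<noteq> y \<longrightarrow> size {#B \<in># \<B>. x \<in> B \<and> y \<in> B#} = lam)"

definition colouring :: "nat \<Rightarrow> 'a set \<Rightarrow> 'c set \<Rightarrow> ('a \<Rightarrow> 'c) \<Rightarrow> bool" where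
  "colouring l V C f \<longleftrightarrow> finite C \<and> card C = l \<and> f ` V = C"

definition zero_ulse_colouring ::
  "nat \<Rightarrow> nat \<Rightarrow> 'a set \<Rightarrow> 'a set multiset \<Rightarrow> 'c set \<Rightarrow> ('a \<Rightarrow> 'c) \<Rightarrow> bool" where
  "zero_ulse_colouring l k V \<B> C f \<longleftrightarrow>
     colouring l V C f \<and> (l - 1) dvd k \<and>
     (\<forall>B \<in># \<B>. \<exists>!c. c \<in> C \<and> c \<notin> f ` B) \<and>
     (\<forall>B \<in># \<B>. \<forall>c \<in> C. c \<in> f ` B \<longrightarrow> card {x \<in> B. f x = c} = k div (l - 1))"

end

theory Submission
  imports Defs
begin

text \<open>
  The blocks are the complements of the planes of \<open>PG(3,3)\<close>, and the colour classes are the lines of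
  a regular spread: a plane contains exactly one line of a spread and meets every other line in one
  of its four points, so the complement of the plane misses one line and contains three points of
  each of the others. In Singer's model the points are the powers of a primitive element \<open>\<omega>\<close> of
  \<open>GF(81)\<close> up to sign, that is, the residues modulo \<open>40\<close>. The planes are then the translates of a
  cyclic difference set, and \<open>GF(9)\<close> gives the spread whose lines are the residue classes modulo
  \<open>10\<close>.
\<close>

text \<open>
  The exponents \<open>n < 40\<close> for which \<open>\<omega>\<^sup>n\<close> has a nonzero constant coefficient, where \<open>\<omega>\<^sup>4 = \<omega> + 1\<close>
  over \<open>GF(3)\<close>.
\<close>
definition singer_list :: "nat list" where
  "singer_list = [0, 4, 7, 8, 10, 11, 12, 13, 16, 17, 19, 21, 22, 23, 24, 26, 28, 29, 30, 31, 32,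
     33, 34, 36, 37, 38, 39]"

text \<open>The translate of \<open>singer_list\<close> by \<open>-i\<close>; stated with
  \<open>x + i\<close> to avoid truncated subtraction and to be symmetric in point and
  index.\<close>

definition singer_block :: "nat \<Rightarrow> nat set" where
  "singer_block i = {x. x < 40 \<and> (x + i) mod 40 \<in> set singer_list}"

lemma distinct_singer_list: "distinct singer_list"
  by (simp add: singer_list_def)

lemma singer_list_less: "e \<in> set singer_list \<Longrightarrow> e < 40"
  by (auto simp: singer_list_def)

lemma card_singer_list_filter:
  "card {e \<in> set singer_list. P e} = length (filter P singer_list)"
  using distinct_length_filter[OF distinct_singer_list, of P]
  by (simp add: Int_def conj_commute)

text \<open>The 13 omitted residues form a \<open>(40,13,4)\<close> difference set, so their
  complement is one with parameter 40 - 2*13 + 4 = 18. Evaluation checks each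
  \<open>d\<close>.\<close>

lemma singer_list_differences:
  assumes "0 < d" "d < 40"
  shows "card {e \<in> set singer_list. (e + d) mod 40 \<in> set singer_list} = 18"
proof -
  have "\<forall>d \<in> set [1..<40].
      length (filter (\<lambda>e. (e + d) mod 40 \<in> set singer_list) singer_list) = 18"
    by code_simp
  with assms show ?thesis
    by (simp add: card_singer_list_filter)
qed

text \<open>The class of 5 is the spread line lying in the omitted plane.\<close>

lemma singer_list_residues:
  assumes "r < 10"
  shows "card {e \<in> set singer_list. e mod 10 = r} = (if r = 5 then 0 else 3)"
proof -
  have "\<forall>r \<in> set [0..<10].
      length (filter (\<lambda>e. e mod 10 = r) singer_list) = (if r = 5 then 0 else 3)"
    by code_simp
  with assms show ?thesis
    by (simp add: card_singer_list_filter)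
qed

lemma bij_betw_add_mod:
  fixes i n :: nat
  assumes "0 < n"
  shows "bij_betw (\<lambda>x. (x + i) mod n) {..<n} {..<n}"
proof -
  have "(x + i) mod n \<noteq> (y + i) mod n" if "x < y" "y < n" for x y
  proof
    assume "(x + i) mod n = (y + i) mod n"
    then have "n dvd y - x"
      using that mod_eq_dvd_iff_nat[of "x + i" "y + i" n] by simp
    with that show False
      by (simp add: nat_dvd_not_less)
  qed
  then have "inj_on (\<lambda>x. (x + i) mod n) {..<n}"
    by (auto intro: linorder_inj_onI)
  moreover have "(\<lambda>x. (x + i) mod n) ` {..<n} \<subseteq> {..<n}"
    using assms by auto
  ultimately show ?thesis
    by (simp add: bij_betw_def endo_inj_surj)
qed

lemma bij_betw_ex1: "bij_betw f A B \<Longrightarrow> y \<in> B \<Longrightarrow> \<exists>!x. x \<in> A \<and> f x = y"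
  unfolding bij_betw_def inj_on_def by blast

text \<open>Serves twice: shifting points by a block index, and shifting indices by a point.\<close>

lemma card_shift:
  fixes i n :: nat
  assumes "0 < n"
  shows "card {x. x < n \<and> P ((x + i) mod n)} = card {e. e < n \<and> P e}"
proof -
  let ?g = "\<lambda>x. (x + i) mod n"
  have g: "inj_on ?g {..<n}" "?g ` {..<n} = {..<n}"
    using bij_betw_add_mod[OF assms] by (simp_all add: bij_betw_def)
  have "?g ` {x. x < n \<and> P (?g x)} = {e \<in> ?g ` {..<n}. P e}"
    by auto
  moreover have "inj_on ?g {x. x < n \<and> P (?g x)}"
    by (rule inj_on_subset[OF g(1)]) auto
  ultimately show ?thesis
    using card_image g(2) by fastforce
qed

lemma card_singer_block_filter:
  "card {x \<in> singer_block i. P ((x + i) mod 40)} = card {e \<in> set singer_list. P e}"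
proof -
  have "{e. e < 40 \<and> e \<in> set singer_list \<and> P e} = {e \<in> set singer_list. P e}"
    using singer_list_less by auto
  with card_shift[of 40 "\<lambda>e. e \<in> set singer_list \<and> P e" i] show ?thesis
    by (simp add: singer_block_def conj_assoc)
qed

lemma card_singer_block: "card (singer_block i) = 27"
  using card_singer_block_filter[of i "\<lambda>_. True"]
  by (simp add: card_singer_list_filter[where P = "\<lambda>_. True", simplified])
    (simp add: singer_list_def)

lemma card_singer_blocks_containing_pair:
  assumes "x < 40" "y < 40" "x \<noteq> y"
  shows "card {i. i < 40 \<and> x \<in> singer_block i \<and> y \<in> singer_block i} = 18"
proof -
  \<comment> \<open>The residue of \<open>y - x\<close> modulo 40. With
    \<open>e = (i + x) mod 40\<close>, both points lie in the block exactly when \<open>e\<close>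
    and \<open>e + d\<close> lie in the difference set.\<close>
  define d where "d = (if x < y then y - x else y + 40 - x)"
  have d: "0 < d" "d < 40"
    using assms by (auto simp: d_def)
  have "i + x + d = (if x < y then y + i else y + i + 40)" for i
    using assms by (simp add: d_def)
  then have "(i + x + d) mod 40 = (y + i) mod 40" for i
    by simp
  then have y: "(y + i) mod 40 = ((i + x) mod 40 + d) mod 40" for i
    by (simp add: mod_add_left_eq)
  have "{i. i < 40 \<and> x \<in> singer_block i \<and> y \<in> singer_block i} =
      {i. i < 40 \<and> (i + x) mod 40 \<in> set singer_list \<and>
        ((i + x) mod 40 + d) mod 40 \<in> set singer_list}"
    using assms by (simp only: singer_block_def y mem_Collect_eq simp_thms add.commute[of x])
  also have "card \<dots> = card {e. e < 40 \<and> e \<in> set singer_list \<and> (e + d) mod 40 \<in> set singer_list}"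
    by (rule card_shift[of 40 "\<lambda>e. e \<in> set singer_list \<and> (e + d) mod 40 \<in> set singer_list"]) simp
  also have "{e. e < 40 \<and> e \<in> set singer_list \<and> (e + d) mod 40 \<in> set singer_list} =
      {e \<in> set singer_list. (e + d) mod 40 \<in> set singer_list}"
    using singer_list_less by auto
  finally show ?thesis
    using singer_list_differences[OF d] by simp
qed

lemma card_singer_block_colour:
  assumes "c < 10"
  shows "card {x \<in> singer_block i. x mod 10 = c} = (if (c + i) mod 10 = 5 then 0 else 3)"
proof -
  have "inj_on (\<lambda>x. (x + i) mod 10) {..<10}"
    using bij_betw_add_mod[of 10 i] by (simp add: bij_betw_def)
  then have "x mod 10 = c \<longleftrightarrow> (x mod 10 + i) mod 10 = (c + i) mod 10" for x
    using assms inj_on_eq_iff[of "\<lambda>x. (x + i) mod 10" "{..<10}" "x mod 10" c] by simp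
  \<comment> \<open>As 10 divides 40, translations permute the spread lines.\<close>
  then have "x mod 10 = c \<longleftrightarrow> (x + i) mod 40 mod 10 = (c + i) mod 10" for x
    by (simp add: mod_mod_cancel mod_add_left_eq)
  then show ?thesis
    using card_singer_block_filter[of i "\<lambda>e. e mod 10 = (c + i) mod 10"]
      singer_list_residues[of "(c + i) mod 10"]
    by simp
qed

lemma finite_singer_block: "finite (singer_block i)"
  by (simp add: singer_block_def)

lemma colour_mem_singer_block_iff:
  assumes "c < 10"
  shows "c \<in> (\<lambda>x. x mod 10) ` singer_block i \<longleftrightarrow> (c + i) mod 10 \<noteq> 5"
proof -
  have "c \<in> (\<lambda>x. x mod 10) ` singer_block i \<longleftrightarrow> {x \<in> singer_block i. x mod 10 = c} \<noteq> {}"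
    by auto
  also have "\<dots> \<longleftrightarrow> card {x \<in> singer_block i. x mod 10 = c} \<noteq> 0"
    using finite_singer_block by simp
  finally show ?thesis
    by (simp add: card_singer_block_colour[OF assms])
qed

lemma bibd_singer: "bibd 40 27 18 {..<40} (image_mset singer_block (mset_set {..<40}))"
proof -
  have "size {#B \<in># image_mset singer_block (mset_set {..<40}). x \<in> B \<and> y \<in> B#} = 18"
    if "x < 40" "y < 40" "x \<noteq> y" for x y
    \<comment> \<open>Counting indices instead of sets matches the multiplicities in the multiset of
      blocks.\<close>
    using card_singer_blocks_containing_pair[OF that]
    by (simp add: filter_mset_image_mset conj_ac)
  then show ?thesis
    by (auto simp: bibd_def card_singer_block) (auto simp: singer_block_def)
qed

lemma zero_ulse_colouring_singer:
  "zero_ulse_colouring 10 27 {..<40} (image_mset singer_block (mset_set {..<40})) {..<10}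
    (\<lambda>x. x mod 10)"
proof -
  have "x \<in> (\<lambda>x. x mod 10) ` {..<40}" if "x < 10" for x :: nat
    using that by (intro image_eqI[of _ _ x]) auto
  then have "(\<lambda>x. x mod 10) ` {..<40} = {..<10::nat}"
    by auto
  moreover have "\<exists>!c. c \<in> {..<10} \<and> c \<notin> (\<lambda>x. x mod 10) ` singer_block i" for i
  proof -
    \<comment> \<open>The missing colour is the residue of \<open>5 - i\<close>.\<close>
    have "\<exists>!c. c \<in> {..<10} \<and> (c + i) mod 10 = 5"
      by (rule bij_betw_ex1[OF bij_betw_add_mod]) simp_all
    moreover have "c \<in> {..<10} \<and> c \<notin> (\<lambda>x. x mod 10) ` singer_block i \<longleftrightarrow>
        c \<in> {..<10} \<and> (c + i) mod 10 = 5" for c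
      unfolding lessThan_iff using colour_mem_singer_block_iff[of c i] by blast
    ultimately show ?thesis
      by (simp only:)
  qed
  moreover have "card {x \<in> singer_block i. x mod 10 = c} = 3"
    if "c < 10" "c \<in> (\<lambda>x. x mod 10) ` singer_block i" for c i
    using that by (simp add: card_singer_block_colour colour_mem_singer_block_iff)
  ultimately show ?thesis
    unfolding zero_ulse_colouring_def colouring_def by simp
qed

theorem theorem7p1:
  "\<exists>(V :: nat set) (\<B> :: nat set multiset) (C :: nat set) (f :: nat \<Rightarrow> nat).
     bibd 40 27 18 V \<B> \<and> zero_ulse_colouring 10 27 V \<B> C f"
  using bibd_singer zero_ulse_colouring_singer by blast

end
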